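(* Let $T$ be a rooted tree and let $G\leq\operatorname{Aut}(T)$ be a branch group. Then all generalized parabolic subgroups of $G$ are weakly maximal, and they are pairwise distinct in the following sense: if $C_1\neq C_2$ are two closed non-open subsets of $\partial T$ such that, for $i=1,2$, the action of $\operatorname{SStab}_G(C_i)$ on $C_i$ is minimal, then $\operatorname{SStab}_G(C_1)\neq\operatorname{SStab}_G(C_2)$.
   Context: All rooted trees are infinite and spherically regular (the number of children of a vertex depends only on its level), and every vertex has at least two children. $\operatorname{Aut}(T)$ is the group of graph automorphisms fixing the root; $\mathcal L_n$ is the set of vertices of level $n$ (at distance $n$ from the root); $T_v$ is the subtree of descendants of $v$. The boundary $\partial T$ is the set of infinite rays starting at the root, with the metric in which two distinct rays first differing at index $i$ are at distance $2^{-i}$; $\operatorname{Aut}(T)$ acts on it by isometries. For $G\le\operatorname{Aut}(T)$, $\operatorname{Rist}_G(v)$ is the subgroup of elements acting trivially outside $T_v$, and $\operatorname{Rist}_G(\mathcal L_n)=\prod_{v\in\mathcal L_n}\operatorname{Rist}_G(v)$. $G$ is branch if it acts transitively on every $\mathcal L_n$ and $\operatorname{Rist}_G(\mathcal L_n)$ has finite index in $G$ for every $n$. For $C\subseteq\partial T$, $\operatorname{SStab}_G(C)$ is the setwise stabilizer of $C$ in $G$. A generalized parabolic subgroup of $G$ is a subgroup of the form $\operatorname{SStab}_G(C)$ where $C\subset\partial T$ is closed and not open and the action $\operatorname{SStab}_G(C)\curvearrowright C$ is minimal (every orbit is dense in $C$). A subgroup is weakly maximal if it is maximal among the subgroups of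 infinite index of $G$. *)

theory Defs
  imports "HOL-Analysis.Analysis" "HOL-Library.Equipollence" "HOL-Algebra.Generated_Groups"
begin

section \<open>Rooted trees\<close>

text \<open>
  A graph is given by its adjacency relation; its vertices are all elements of the type
  of the relation.
\<close>

definition simple_path :: "('v \<Rightarrow> 'v \<Rightarrow> bool) \<Rightarrow> 'v \<Rightarrow> 'v list \<Rightarrow> 'v \<Rightarrow> bool" where
  "simple_path adj u p v \<longleftrightarrow>
     p \<noteq> [] \<and> hd p = u \<and> last p = v \<and> distinct p \<and> successively adj p"

definition is_tree :: "('v \<Rightarrow> 'v \<Rightarrow> bool) \<Rightarrow> bool" where
  "is_tree adj \<longleftrightarrow> symp adj \<and> irreflp adj \<and> (\<forall>u v. \<exists>!p. simple_path adj u p v)"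

definition graph_dist :: "('v \<Rightarrow> 'v \<Rightarrow> bool) \<Rightarrow> 'v \<Rightarrow> 'v \<Rightarrow> nat" where
  "graph_dist adj u v = (LEAST n. (adj ^^ n) u v)"

definition level :: "('v \<Rightarrow> 'v \<Rightarrow> bool) \<Rightarrow> 'v \<Rightarrow> nat \<Rightarrow> 'v set" where
  "level adj r n = {v. graph_dist adj r v = n}"

definition children :: "('v \<Rightarrow> 'v \<Rightarrow> bool) \<Rightarrow> 'v \<Rightarrow> 'v \<Rightarrow> 'v set" where
  "children adj r v = {w. adj v w \<and> graph_dist adj r w = Suc (graph_dist adj r v)}"

text \<open>
  Local finiteness is not assumed, so the numbers of children are compared as cardinalities.
  The tree is infinite because every vertex has a child.
\<close>

definition rooted_tree :: "('v \<Rightarrow> 'v \<Rightarrow> bool) \<Rightarrow> 'v \<Rightarrow> bool" where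
  "rooted_tree adj r \<longleftrightarrow>
     is_tree adj \<and>
     (\<forall>n. \<forall>u\<in>level adj r n. \<forall>v\<in>level adj r n. children adj r u \<approx> children adj r v) \<and>
     (\<forall>v. \<exists>a\<in>children adj r v. \<exists>b\<in>children adj r v. a \<noteq> b)"

definition subtree :: "('v \<Rightarrow> 'v \<Rightarrow> bool) \<Rightarrow> 'v \<Rightarrow> 'v \<Rightarrow> 'v set" where
  "subtree adj r v = {w. \<exists>p. simple_path adj r p w \<and> v \<in> set p}"


section \<open>The boundary\<close>

definition boundary :: "('v \<Rightarrow> 'v \<Rightarrow> bool) \<Rightarrow> 'v \<Rightarrow> (nat \<Rightarrow> 'v) set" where
  "boundary adj r = {\<xi>. \<xi> 0 = r \<and> (\<forall>n. adj (\<xi> n) (\<xi> (Suc n))) \<and> inj \<xi>}"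

definition ray_dist :: "(nat \<Rightarrow> 'v) \<Rightarrow> (nat \<Rightarrow> 'v) \<Rightarrow> real" where
  "ray_dist \<xi> \<eta> = (if \<xi> = \<eta> then 0 else (1 / 2) ^ (LEAST i. \<xi> i \<noteq> \<eta> i))"

lemma Metric_space_boundary: "Metric_space (boundary adj r) ray_dist"
proof
  fix x y z :: "nat \<Rightarrow> 'v"
  show "0 \<le> ray_dist x y" by (simp add: ray_dist_def)
  show "ray_dist x y = ray_dist y x"
  proof -
    have "(\<lambda>i. x i \<noteq> y i) = (\<lambda>i. y i \<noteq> x i)" by auto
    then show ?thesis unfolding ray_dist_def by auto
  qed
  show "ray_dist x y = 0 \<longleftrightarrow> x = y" by (simp add: ray_dist_def)
  show "ray_dist x z \<le> ray_dist x y + ray_dist y z"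
  proof (cases "x = z \<or> x = y \<or> y = z")
    case True
    then show ?thesis by (elim disjE) (simp_all add: ray_dist_def)
  next
    case False
    define i where "i = (LEAST i. x i \<noteq> z i)"
    define j where "j = (LEAST i. x i \<noteq> y i)"
    define k where "k = (LEAST i. y i \<noteq> z i)"
    have "\<exists>i. x i \<noteq> z i" using False by auto
    then have "x i \<noteq> z i" unfolding i_def by (rule LeastI_ex)
    then have "x i \<noteq> y i \<or> y i \<noteq> z i" by auto
    moreover have "x i \<noteq> y i \<Longrightarrow> j \<le> i" "y i \<noteq> z i \<Longrightarrow> k \<le> i"
      unfolding j_def k_def by (rule Least_le, assumption)+
    ultimately have "j \<le> i \<or> k \<le> i" by blast
    moreover have "((1 / 2) ^ b :: real) \<le> (1 / 2) ^ a" if "a \<le> b" for a b :: nat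
      using that by (rule power_decreasing) simp_all
    ultimately have "((1 / 2) ^ i :: real) \<le> (1 / 2) ^ j \<or> ((1 / 2) ^ i :: real) \<le> (1 / 2) ^ k"
      by blast
    moreover have "0 \<le> ((1 / 2) ^ j :: real)" "0 \<le> ((1 / 2) ^ k :: real)" by simp_all
    ultimately have "((1 / 2) ^ i :: real) \<le> (1 / 2) ^ j + (1 / 2) ^ k" by linarith
    moreover have "ray_dist x z = (1 / 2) ^ i" "ray_dist x y = (1 / 2) ^ j"
      "ray_dist y z = (1 / 2) ^ k"
      using False unfolding ray_dist_def i_def j_def k_def by (simp_all only: if_False de_Morgan_disj)
    ultimately show ?thesis by linarith
  qed
qed

definition boundary_top :: "('v \<Rightarrow> 'v \<Rightarrow> bool) \<Rightarrow> 'v \<Rightarrow> (nat \<Rightarrow> 'v) topology" where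
  "boundary_top adj r = Metric_space.mtopology (boundary adj r) ray_dist"

lemma topspace_boundary_top: "topspace (boundary_top adj r) = boundary adj r"
  unfolding boundary_top_def
  by (rule Metric_space.topspace_mtopology[OF Metric_space_boundary])


section \<open>Automorphism groups and branch groups\<close>

definition tree_Aut :: "('v \<Rightarrow> 'v \<Rightarrow> bool) \<Rightarrow> 'v \<Rightarrow> ('v \<Rightarrow> 'v) monoid" where
  "tree_Aut adj r =
     \<lparr>carrier = {g. bij g \<and> (\<forall>u v. adj (g u) (g v) \<longleftrightarrow> adj u v) \<and> g r = r},
      mult = (\<circ>), one = id\<rparr>"

lemma group_tree_Aut: "group (tree_Aut adj r)"
proof (rule groupI)
  show "\<exists>h\<in>carrier (tree_Aut adj r). h \<otimes>\<^bsub>tree_Aut adj r\<^esub> g = \<one>\<^bsub>tree_Aut adj r\<^esub>"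
    if g: "g \<in> carrier (tree_Aut adj r)" for g
  proof -
    from g have b: "bij g" and a: "\<And>u v. adj (g u) (g v) \<longleftrightarrow> adj u v" and r: "g r = r"
      by (simp_all add: tree_Aut_def)
    have "adj (inv_into UNIV g u) (inv_into UNIV g v) \<longleftrightarrow> adj u v" for u v
      using a[of "inv_into UNIV g u" "inv_into UNIV g v"] b
      by (simp add: bij_is_surj surj_f_inv_f)
    moreover have "inv_into UNIV g r = r"
      using r b by (metis bij_is_inj inv_f_f)
    ultimately have "inv_into UNIV g \<in> carrier (tree_Aut adj r)"
      using b by (simp add: tree_Aut_def bij_imp_bij_inv)
    moreover have "inv_into UNIV g \<circ> g = id" using b by (simp add: bij_is_inj)
    ultimately show ?thesis by (intro bexI[of _ "inv_into UNIV g"]) (simp_all add: tree_Aut_def)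
  qed
qed (simp_all add: tree_Aut_def bij_comp comp_assoc)

definition Rist :: "('v \<Rightarrow> 'v \<Rightarrow> bool) \<Rightarrow> 'v \<Rightarrow> ('v \<Rightarrow> 'v) set \<Rightarrow> 'v \<Rightarrow> ('v \<Rightarrow> 'v) set" where
  "Rist adj r G v = {g \<in> G. \<forall>w. w \<notin> subtree adj r v \<longrightarrow> g w = w}"

text \<open>
  The groups \<open>Rist adj r G v\<close>, for \<open>v\<close> in one level, have disjoint supports and hence commute
  pairwise; their internal product is the subgroup that they generate.
\<close>

definition Rist_level ::
    "('v \<Rightarrow> 'v \<Rightarrow> bool) \<Rightarrow> 'v \<Rightarrow> ('v \<Rightarrow> 'v) set \<Rightarrow> nat \<Rightarrow> ('v \<Rightarrow> 'v) set" where
  "Rist_level adj r G n = generate (tree_Aut adj r) (\<Union>v\<in>level adj r n. Rist adj r G v)"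

definition finite_index :: "('a, 'b) monoid_scheme \<Rightarrow> 'a set \<Rightarrow> bool" where
  "finite_index \<Gamma> H \<longleftrightarrow> finite (rcosets\<^bsub>\<Gamma>\<^esub> H)"

definition branch_group :: "('v \<Rightarrow> 'v \<Rightarrow> bool) \<Rightarrow> 'v \<Rightarrow> ('v \<Rightarrow> 'v) set \<Rightarrow> bool" where
  "branch_group adj r G \<longleftrightarrow>
     subgroup G (tree_Aut adj r) \<and>
     (\<forall>n. \<forall>u\<in>level adj r n. \<forall>v\<in>level adj r n. \<exists>g\<in>G. g u = v) \<and>
     (\<forall>n. finite_index (tree_Aut adj r\<lparr>carrier := G\<rparr>) (Rist_level adj r G n))"


section \<open>Generalized parabolic and weakly maximal subgroups\<close>

text \<open>A tree automorphism \<open>g\<close> sends a ray \<open>\<xi>\<close> to the ray \<open>g \<circ> \<xi>\<close>.\<close>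

definition SStab :: "('v \<Rightarrow> 'v) set \<Rightarrow> (nat \<Rightarrow> 'v) set \<Rightarrow> ('v \<Rightarrow> 'v) set" where
  "SStab G C = {g \<in> G. (\<lambda>\<xi>. g \<circ> \<xi>) ` C = C}"

definition minimal_action ::
    "('v \<Rightarrow> 'v \<Rightarrow> bool) \<Rightarrow> 'v \<Rightarrow> ('v \<Rightarrow> 'v) set \<Rightarrow> (nat \<Rightarrow> 'v) set \<Rightarrow> bool" where
  "minimal_action adj r H C \<longleftrightarrow>
     (\<forall>\<xi>\<in>C. subtopology (boundary_top adj r) C closure_of ((\<lambda>g. g \<circ> \<xi>) ` H) = C)"

definition generalized_parabolic ::
    "('v \<Rightarrow> 'v \<Rightarrow> bool) \<Rightarrow> 'v \<Rightarrow> ('v \<Rightarrow> 'v) set \<Rightarrow> ('v \<Rightarrow> 'v) set \<Rightarrow> bool" where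
  "generalized_parabolic adj r G H \<longleftrightarrow>
     (\<exists>C. closedin (boundary_top adj r) C \<and> \<not> openin (boundary_top adj r) C \<and>
          minimal_action adj r (SStab G C) C \<and> H = SStab G C)"

definition weakly_maximal :: "('a, 'b) monoid_scheme \<Rightarrow> 'a set \<Rightarrow> bool" where
  "weakly_maximal \<Gamma> H \<longleftrightarrow>
     subgroup H \<Gamma> \<and> \<not> finite_index \<Gamma> H \<and>
     (\<forall>K. subgroup K \<Gamma> \<and> \<not> finite_index \<Gamma> K \<and> H \<subseteq> K \<longrightarrow> K = H)"

end

theory Submission
  imports Defs
begin

text \<open>
  Write \<open>H = SStab G C\<close> and let \<open>V\<close> be the set of vertices on rays of \<open>C\<close>. Since \<open>C\<close> is closed, a
  ray outside \<open>C\<close> passes through a vertex outside \<open>V\<close>, and \<open>Rist G u\<close> fixes \<open>C\<close> pointwise for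
  \<open>u \<notin> V\<close>. By minimality \<open>H\<close> acts transitively on each level of \<open>V\<close>; so an overgroup of \<open>H\<close>
  containing \<open>Rist G w\<close> for a single \<open>w \<in> V\<close> of level \<open>n\<close> contains \<open>Rist G u\<close> for all \<open>u\<close> of level
  \<open>n\<close>, and has finite index because \<open>G\<close> is branch.

  If \<open>H\<close> had finite index, finitely many translates of \<open>V\<close> would cover the tree, so \<open>V\<close> would
  contain a full subtree, and by minimality \<open>C\<close> would be open. An overgroup \<open>K\<close> of \<open>H\<close> in which
  some \<open>g\<close> moves a ray of \<open>C\<close> out of \<open>C\<close> contains \<open>Rist G u\<close> for some \<open>u \<notin> V\<close> with
  \<open>g\<inverse> u \<in> V\<close>; conjugating by \<open>g\<close> shows that \<open>K\<close> has finite index. Likewise, if \<open>H = SStab G D\<close> and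
  some ray of \<open>C\<close> is not in \<open>D\<close>, then \<open>H\<close> contains \<open>Rist G w\<close> for some \<open>w \<in> V\<close>, which is
  impossible.
\<close>

section \<open>Paths and rays\<close>

lemma simple_path_unique:
  assumes "is_tree adj" "simple_path adj u p v" "simple_path adj u q v"
  shows "p = q"
  using assms unfolding is_tree_def by blast

lemma simple_path_map_upt:
  assumes "inj_on f {..n}" and "\<And>i. i < n \<Longrightarrow> adj (f i) (f (Suc i))"
  shows "simple_path adj (f 0) (map f [0..<Suc n]) (f n)"
proof -
  have "inj_on f {0..<Suc n}"
    using assms(1) by (simp add: atLeast0LessThan lessThan_Suc_atMost)
  moreover have "successively adj (map f [0..<Suc n])"
    unfolding successively_map successively_conv_nth using assms(2) by (auto simp del: upt_Suc)
  ultimately show ?thesis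
    unfolding simple_path_def by (simp add: distinct_map hd_map last_map del: upt_Suc)
qed

text \<open>A walk of minimal length repeats no vertex, so it is the unique simple path.\<close>

lemma length_simple_path:
  assumes tree: "is_tree adj" and p: "simple_path adj u p v"
  shows "length p = Suc (graph_dist adj u v)"
proof -
  define m where "m = graph_dist adj u v"
  \<comment> \<open>The path \<open>p\<close> is itself a walk, so the minimum that defines
    \<open>graph_dist\<close> is attained.\<close>
  have "(adj ^^ (length p - 1)) u v"
    unfolding relpowp_fun_conv using p
    by (intro exI[of _ "\<lambda>i. p ! i"])
       (auto simp: simple_path_def hd_conv_nth last_conv_nth successively_conv_nth)
  then have m: "(adj ^^ m) u v" unfolding m_def graph_dist_def by (rule LeastI)
  then obtain f where f: "f 0 = u" "f m = v" "\<And>i. i < m \<Longrightarrow> adj (f i) (f (Suc i))"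
    unfolding relpowp_fun_conv by blast
  \<comment> \<open>Cutting the loop between \<open>f i\<close> and \<open>f j\<close> out of the
    walk would leave one of length \<open>i + (m - j) < m\<close>.\<close>
  have less: "f i \<noteq> f j" if "i < j" "j \<le> m" for i j
  proof
    assume eq: "f i = f j"
    have "(adj ^^ i) u (f i)"
      unfolding relpowp_fun_conv using f that by (intro exI[of _ f]) auto
    moreover have "(adj ^^ (m - j)) (f j) v"
      unfolding relpowp_fun_conv using f that by (intro exI[of _ "\<lambda>k. f (j + k)"]) auto
    ultimately have "(adj ^^ (i + (m - j))) u v"
      using eq unfolding relpowp_add by auto
    then have "m \<le> i + (m - j)" unfolding m_def graph_dist_def by (rule Least_le)
    with that show False by linarith
  qed
  have "inj_on f {..m}"
    by (rule inj_onI) (metis atMost_iff less linorder_neqE_nat)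
  from simple_path_map_upt[of f m adj, OF this f(3)] have "simple_path adj u (map f [0..<Suc m]) v"
    using f by simp
  from simple_path_unique[OF tree p this] show ?thesis by (simp add: m_def)
qed

lemma simple_path_ray:
  assumes "\<xi> \<in> boundary adj r"
  shows "simple_path adj r (map \<xi> [0..<Suc n]) (\<xi> n)"
  using simple_path_map_upt[of \<xi> n adj] assms by (simp add: boundary_def inj_on_def del: upt_Suc)

lemma graph_dist_ray:
  assumes "is_tree adj" "\<xi> \<in> boundary adj r"
  shows "graph_dist adj r (\<xi> n) = n"
  using length_simple_path[OF assms(1) simple_path_ray[OF assms(2), of n]] by simp

lemma ray_vertex_level_unique:
  assumes "is_tree adj" "\<xi> \<in> boundary adj r" "\<eta> \<in> boundary adj r" "\<xi> i = \<eta> j"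
  shows "i = j"
  using graph_dist_ray[OF assms(1,2), of i] graph_dist_ray[OF assms(1,3), of j] assms(4) by simp

text \<open>Both initial segments up to \<open>n\<close> are the unique simple path from
  \<open>r\<close> to the common vertex.\<close>

lemma rays_agree_below:
  assumes "is_tree adj" "\<xi> \<in> boundary adj r" "\<eta> \<in> boundary adj r" "\<xi> n = \<eta> n" "i \<le> n"
  shows "\<xi> i = \<eta> i"
proof -
  have "map \<xi> [0..<Suc n] = map \<eta> [0..<Suc n]"
    using simple_path_unique[OF assms(1) simple_path_ray[OF assms(2), of n]]
      simple_path_ray[OF assms(3), of n] assms(4) by metis
  with assms(5) show ?thesis by (auto simp del: upt_Suc)
qed

lemma subtree_ray_iff:
  assumes "is_tree adj" "\<xi> \<in> boundary adj r"
  shows "\<xi> n \<in> subtree adj r v \<longleftrightarrow> (\<exists>i\<le>n. v = \<xi> i)"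
proof -
  have "\<xi> n \<in> subtree adj r v \<longleftrightarrow> v \<in> set (map \<xi> [0..<Suc n])"
    unfolding subtree_def
    using simple_path_ray[OF assms(2), of n] simple_path_unique[OF assms(1)] by blast
  then show ?thesis by (auto simp: less_Suc_eq_le simp del: upt_Suc)
qed

lemma subtree_refl:
  assumes "is_tree adj"
  shows "v \<in> subtree adj r v"
  using assms unfolding is_tree_def subtree_def simple_path_def by (auto; metis last_in_set)

text \<open>The part of the path to \<open>w\<close> that ends at \<open>v\<close> is the unique
  simple path to \<open>v\<close>, hence runs through \<open>u\<close>.\<close>

lemma subtree_trans:
  assumes "is_tree adj" "w \<in> subtree adj r v" "v \<in> subtree adj r u"
  shows "w \<in> subtree adj r u"
proof -
  obtain p where p: "simple_path adj r p w" "v \<in> set p" using assms(2) by (auto simp: subtree_def)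
  obtain q where q: "simple_path adj r q v" "u \<in> set q" using assms(3) by (auto simp: subtree_def)
  obtain xs ys where xs: "p = xs @ v # ys" using p(2) by (auto dest: split_list)
  have "successively adj ((xs @ [v]) @ ys)" using p(1) xs by (simp add: simple_path_def)
  then have "successively adj (xs @ [v])" unfolding successively_append_iff by blast
  then have "simple_path adj r (xs @ [v]) v"
    using p(1) unfolding xs simple_path_def by (cases xs) auto
  then have "q = xs @ [v]" using simple_path_unique[OF assms(1) q(1)] by simp
  then show ?thesis using p(1) q(2) xs unfolding subtree_def by auto
qed

section \<open>Cylinder sets\<close>

text \<open>For distinct rays with first difference at \<open>k\<close>, both sides say
  \<open>n < k\<close>, because rays that have split never meet again. So balls of radius
  \<open>(1 / 2) ^ n\<close> are cylinders.\<close>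

lemma ray_dist_less_iff:
  assumes "is_tree adj" "\<xi> \<in> boundary adj r" "\<eta> \<in> boundary adj r"
  shows "ray_dist \<xi> \<eta> < (1 / 2) ^ n \<longleftrightarrow> \<xi> n = \<eta> n"
proof (cases "\<xi> = \<eta>")
  case False
  define k where "k = (LEAST i. \<xi> i \<noteq> \<eta> i)"
  have "\<exists>i. \<xi> i \<noteq> \<eta> i" using False by auto
  then have k: "\<xi> k \<noteq> \<eta> k" unfolding k_def by (rule LeastI_ex)
  have "\<xi> i = \<eta> i" if "i < k" for i using not_less_Least that unfolding k_def by blast
  then have "\<xi> n = \<eta> n \<longleftrightarrow> n < k"
    using k rays_agree_below[OF assms, of n k] by (meson not_less)
  moreover have "ray_dist \<xi> \<eta> = (1 / 2) ^ k" using False by (simp add: ray_dist_def k_def)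
  ultimately show ?thesis by (simp add: power_strict_decreasing_iff)
qed (simp add: ray_dist_def)

text \<open>From here on the metric enters only through this description by cylinders.\<close>

lemma openin_boundary_top_iff:
  assumes "is_tree adj"
  shows "openin (boundary_top adj r) U \<longleftrightarrow>
    U \<subseteq> boundary adj r \<and> (\<forall>\<xi>\<in>U. \<exists>n. \<forall>\<eta>\<in>boundary adj r. \<eta> n = \<xi> n \<longrightarrow> \<eta> \<in> U)"
proof -
  interpret Metric_space "boundary adj r" ray_dist by (rule Metric_space_boundary)
  have "(\<exists>e>0. mball \<xi> e \<subseteq> U) \<longleftrightarrow> (\<exists>n. \<forall>\<eta>\<in>boundary adj r. \<eta> n = \<xi> n \<longrightarrow> \<eta> \<in> U)"
    if U: "U \<subseteq> boundary adj r" "\<xi> \<in> U" for \<xi>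
  proof -
    have \<xi>: "\<xi> \<in> boundary adj r" using U by auto
    have cyl: "mball \<xi> ((1 / 2) ^ n) = {\<eta> \<in> boundary adj r. \<eta> n = \<xi> n}" for n
      using \<xi> ray_dist_less_iff[OF assms \<xi>] by (auto simp: in_mball)
    show ?thesis
    proof
      assume "\<exists>e>0. mball \<xi> e \<subseteq> U"
      then obtain e where e: "e > 0" "mball \<xi> e \<subseteq> U" by blast
      obtain n where "(1 / 2) ^ n < e" using real_arch_pow_inv[OF e(1), of "1/2"] by auto
      then have "mball \<xi> ((1 / 2) ^ n) \<subseteq> U" using e(2) mball_subset_concentric[of "(1/2)^n" e] by force
      then show "\<exists>n. \<forall>\<eta>\<in>boundary adj r. \<eta> n = \<xi> n \<longrightarrow> \<eta> \<in> U" unfolding cyl by blast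
    next
      assume "\<exists>n. \<forall>\<eta>\<in>boundary adj r. \<eta> n = \<xi> n \<longrightarrow> \<eta> \<in> U"
      then obtain n where "mball \<xi> ((1 / 2) ^ n) \<subseteq> U" unfolding cyl by blast
      then show "\<exists>e>0. mball \<xi> e \<subseteq> U" by (intro exI[of _ "(1 / 2) ^ n"]) simp
    qed
  qed
  then show ?thesis unfolding boundary_top_def openin_mtopology by auto
qed

text \<open>Some cylinder around \<open>\<xi>\<close> misses \<open>C\<close>. An index on a ray is
  the level of the vertex there, so \<open>\<xi> n\<close> cannot occur on a ray of \<open>C\<close>
  at another index either.\<close>

lemma closedin_boundary_top_separate:
  assumes "is_tree adj" "closedin (boundary_top adj r) C" "\<xi> \<in> boundary adj r" "\<xi> \<notin> C"
  obtains n where "\<And>\<eta> m. \<eta> \<in> C \<Longrightarrow> \<xi> n \<noteq> \<eta> m"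
proof -
  have C: "C \<subseteq> boundary adj r" "openin (boundary_top adj r) (boundary adj r - C)"
    using assms(2) by (simp_all add: closedin_def topspace_boundary_top)
  with assms obtain n where n: "\<And>\<eta>. \<eta> \<in> boundary adj r \<Longrightarrow> \<eta> n = \<xi> n \<Longrightarrow> \<eta> \<notin> C"
    unfolding openin_boundary_top_iff[OF assms(1)] by blast
  show thesis
  proof (rule that)
    show "\<xi> n \<noteq> \<eta> m" if "\<eta> \<in> C" for \<eta> m
      using n[of \<eta>] that C(1) ray_vertex_level_unique[OF assms(1,3), of \<eta> n m]
      by (metis subsetD)
  qed
qed

text \<open>The orbit of \<open>\<xi>\<close> is dense in \<open>C\<close>, so it meets the cylinder
  of rays through \<open>\<eta> n\<close>.\<close>

lemma minimal_action_transitive: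
  assumes "is_tree adj" "C \<subseteq> boundary adj r" "minimal_action adj r H C" "\<xi> \<in> C" "\<eta> \<in> C"
  obtains h where "h \<in> H" "h (\<xi> n) = \<eta> n"
proof -
  let ?U = "{\<zeta> \<in> boundary adj r. \<zeta> n = \<eta> n}"
  have "\<eta> \<in> subtopology (boundary_top adj r) C closure_of ((\<lambda>g. g \<circ> \<xi>) ` H)"
    using assms(3-5) unfolding minimal_action_def by simp
  then have *: "\<exists>\<zeta>. \<zeta> \<in> (\<lambda>g. g \<circ> \<xi>) ` H \<and> \<zeta> \<in> U"
    if "\<eta> \<in> U" "openin (subtopology (boundary_top adj r) C) U" for U
    using that by (simp only: in_closure_of)
  have "openin (subtopology (boundary_top adj r) C) (C \<inter> ?U)"
    by (rule openin_subtopology_Int2)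
       (auto simp: openin_boundary_top_iff[OF assms(1)] intro: exI[of _ n])
  moreover have "\<eta> \<in> C \<inter> ?U" using assms(2,5) by auto
  ultimately obtain h where "h \<in> H" "h \<circ> \<xi> \<in> ?U" using *[of "C \<inter> ?U"] by auto
  then show thesis using that by simp
qed

section \<open>Groups of tree automorphisms\<close>

lemma in_tree_Aut_iff:
  "g \<in> carrier (tree_Aut adj r) \<longleftrightarrow> bij g \<and> (\<forall>u v. adj (g u) (g v) \<longleftrightarrow> adj u v) \<and> g r = r"
  by (simp add: tree_Aut_def)

lemma inv_tree_Aut:
  assumes "g \<in> carrier (tree_Aut adj r)"
  shows "inv\<^bsub>tree_Aut adj r\<^esub> g = inv_into UNIV g"
proof -
  interpret group "tree_Aut adj r" by (rule group_tree_Aut)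
  have "g \<circ> inv\<^bsub>tree_Aut adj r\<^esub> g = id"
    using r_inv[OF assms] by (simp add: tree_Aut_def)
  with assms show ?thesis
    by (metis bij_is_inj comp_assoc comp_id id_comp in_tree_Aut_iff inv_o_cancel)
qed

lemma subgroup_tree_Aut_iff:
  "subgroup H (tree_Aut adj r) \<longleftrightarrow>
    H \<subseteq> carrier (tree_Aut adj r) \<and> id \<in> H \<and> (\<forall>g\<in>H. inv_into UNIV g \<in> H) \<and> (\<forall>g\<in>H. \<forall>h\<in>H. g \<circ> h \<in> H)"
proof -
  have "(\<forall>g\<in>H. inv\<^bsub>tree_Aut adj r\<^esub> g \<in> H) \<longleftrightarrow> (\<forall>g\<in>H. inv_into UNIV g \<in> H)"
    if "H \<subseteq> carrier (tree_Aut adj r)" using that inv_tree_Aut by (metis subsetD)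
  then show ?thesis
    unfolding subgroup_def by (auto simp: tree_Aut_def)
qed

lemma tree_Aut_ray:
  assumes "g \<in> carrier (tree_Aut adj r)" "\<xi> \<in> boundary adj r"
  shows "g \<circ> \<xi> \<in> boundary adj r"
  using assms by (auto simp: in_tree_Aut_iff boundary_def bij_is_inj intro: inj_compose)

lemma tree_Aut_subtree:
  assumes "g \<in> carrier (tree_Aut adj r)" "w \<in> subtree adj r v"
  shows "g w \<in> subtree adj r (g v)"
proof -
  obtain p where p: "simple_path adj r p w" "v \<in> set p"
    using assms(2) by (auto simp: subtree_def)
  have "simple_path adj r (map g p) (g w)"
    using p(1) assms(1) unfolding simple_path_def in_tree_Aut_iff
    by (auto simp: hd_map last_map distinct_map successively_map bij_is_inj
        inj_on_subset[OF _ subset_UNIV])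
  then show ?thesis using p(2) unfolding subtree_def by auto
qed

lemma Rist_conjugate:
  assumes G: "subgroup G (tree_Aut adj r)" and "g \<in> G" "a \<in> Rist adj r G (g v)"
  shows "inv_into UNIV g \<circ> a \<circ> g \<in> Rist adj r G v"
proof -
  have g: "g \<in> carrier (tree_Aut adj r)" "inv_into UNIV g \<in> carrier (tree_Aut adj r)"
    using assms(1,2) by (auto simp: subgroup_tree_Aut_iff)
  then have inj: "inv_into UNIV g (g x) = x" for x by (simp add: in_tree_Aut_iff bij_is_inj)
  \<comment> \<open>Outside the subtree of \<open>v\<close>, \<open>g\<close> leads outside the
    subtree of \<open>g v\<close>, where \<open>a\<close> is trivial.\<close>
  have "g w \<notin> subtree adj r (g v)" if "w \<notin> subtree adj r v" for w
    using tree_Aut_subtree[OF g(2), of "g w" "g v"] that by (auto simp: inj)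
  with assms show ?thesis
    by (auto simp: Rist_def subgroup_tree_Aut_iff inj)
qed

text \<open>Conjugating \<open>a\<close> back by \<open>g\<close> lands in
  \<open>Rist adj r G v\<close>, hence in \<open>K\<close>; conjugating forward again stays in
  \<open>K\<close>.\<close>

lemma Rist_subset_conjugate:
  assumes G: "subgroup G (tree_Aut adj r)" and K: "subgroup K (tree_Aut adj r)"
    and "g \<in> G" "g \<in> K" "Rist adj r G v \<subseteq> K"
  shows "Rist adj r G (g v) \<subseteq> K"
proof
  fix a assume "a \<in> Rist adj r G (g v)"
  then have "inv_into UNIV g \<circ> a \<circ> g \<in> K" using Rist_conjugate[OF G assms(3)] assms(5) by blast
  then have "g \<circ> (inv_into UNIV g \<circ> a \<circ> g) \<circ> inv_into UNIV g \<in> K"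
    using K assms(4) by (auto simp: subgroup_tree_Aut_iff)
  moreover have "bij g" using G assms(3) by (auto simp: subgroup_tree_Aut_iff in_tree_Aut_iff)
  then have "g \<circ> (inv_into UNIV g \<circ> a \<circ> g) \<circ> inv_into UNIV g = a"
    by (auto simp: fun_eq_iff bij_is_surj surj_f_inv_f)
  ultimately show "a \<in> K" by simp
qed

lemma subgroup_SStab:
  assumes "subgroup G (tree_Aut adj r)"
  shows "subgroup (SStab G C) (tree_Aut adj r)"
proof -
  \<comment> \<open>\<open>SStab\<close> asks for equality of \<open>C\<close> with its image, so
    the inverse can be applied to both sides.\<close>
  have "inv_into UNIV g \<in> SStab G C" if "g \<in> SStab G C" for g
  proof -
    have g: "g \<in> G" "(\<lambda>\<xi>. g \<circ> \<xi>) ` C = C" using that by (auto simp: SStab_def)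
    then have "inj g" using assms by (auto simp: subgroup_tree_Aut_iff in_tree_Aut_iff bij_is_inj)
    then have "(\<lambda>\<xi>. inv_into UNIV g \<circ> \<xi>) ` (\<lambda>\<xi>. g \<circ> \<xi>) ` C = C"
      by (simp add: image_image comp_assoc[symmetric])
    with g assms show ?thesis by (simp add: SStab_def subgroup_tree_Aut_iff)
  qed
  moreover have "g \<circ> h \<in> SStab G C" if "g \<in> SStab G C" "h \<in> SStab G C" for g h
  proof -
    have "(\<lambda>\<xi>. g \<circ> h \<circ> \<xi>) ` C = (\<lambda>\<xi>. g \<circ> \<xi>) ` (\<lambda>\<xi>. h \<circ> \<xi>) ` C"
      by (simp add: image_image comp_assoc)
    with that assms show ?thesis by (simp add: SStab_def subgroup_tree_Aut_iff)
  qed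
  ultimately show ?thesis
    using assms by (auto simp: SStab_def subgroup_tree_Aut_iff)
qed

section \<open>Subgroups of finite index\<close>

lemma subgroup_carrier_update_iff:
  assumes "group \<Gamma>" "subgroup G \<Gamma>"
  shows "subgroup H (\<Gamma>\<lparr>carrier := G\<rparr>) \<longleftrightarrow> subgroup H \<Gamma> \<and> H \<subseteq> G"
  using group.incl_subgroup[OF assms] group.subgroup_incl[OF assms(1) _ assms(2)]
    subgroup.subset[of H "\<Gamma>\<lparr>carrier := G\<rparr>"] by auto

text \<open>Since \<open>K H = K\<close>, the coset \<open>K g\<close> is \<open>K\<close> times
  \<open>H g\<close>; so multiplication by \<open>K\<close> maps the cosets of \<open>H\<close> onto
  those of \<open>K\<close>.\<close>

lemma finite_index_mono:
  assumes "group \<Gamma>" "subgroup K \<Gamma>" "\<one>\<^bsub>\<Gamma>\<^esub> \<in> H" "H \<subseteq> K" "finite_index \<Gamma> H"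
  shows "finite_index \<Gamma> K"
proof -
  interpret group \<Gamma> by fact
  have K: "K \<subseteq> carrier \<Gamma>" by (rule subgroup.subset[OF assms(2)])
  have "K #>\<^bsub>\<Gamma>\<^esub> g = K <#>\<^bsub>\<Gamma>\<^esub> (H #>\<^bsub>\<Gamma>\<^esub> g)" if g: "g \<in> carrier \<Gamma>" for g
  proof -
    have "K <#>\<^bsub>\<Gamma>\<^esub> H = K"
    proof
      show "K <#>\<^bsub>\<Gamma>\<^esub> H \<subseteq> K"
        using assms(4) subgroup.m_closed[OF assms(2)] by (auto simp: set_mult_def)
      show "K \<subseteq> K <#>\<^bsub>\<Gamma>\<^esub> H"
      proof
        fix k assume "k \<in> K"
        then have "k \<otimes>\<^bsub>\<Gamma>\<^esub> \<one>\<^bsub>\<Gamma>\<^esub> = k" using K by auto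
        with \<open>k \<in> K\<close> assms(3) show "k \<in> K <#>\<^bsub>\<Gamma>\<^esub> H" unfolding set_mult_def by force
      qed
    qed
    then show ?thesis using setmult_rcos_assoc[OF K _ g, of H] K assms(4) by auto
  qed
  then have "rcosets\<^bsub>\<Gamma>\<^esub> K = (\<lambda>A. K <#>\<^bsub>\<Gamma>\<^esub> A) ` (rcosets\<^bsub>\<Gamma>\<^esub> H)"
    unfolding RCOSETS_def by (auto simp: image_iff)
  with assms(5) show ?thesis unfolding finite_index_def by simp
qed

text \<open>Index is defined by right cosets, but the covering argument needs \<open>H\<close> on
  the right, so that \<open>g = k \<circ> h\<close> moves an \<open>H\<close>-invariant set just as
  \<open>k\<close> does. Inverting right coset representatives switches sides.\<close>

lemma finite_index_transversal:
  assumes G: "subgroup G (tree_Aut adj r)" and H: "subgroup H (tree_Aut adj r)"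
    and fin: "finite_index (tree_Aut adj r\<lparr>carrier := G\<rparr>) H"
  obtains F where "finite F" "F \<subseteq> G" "\<And>g. g \<in> G \<Longrightarrow> \<exists>k\<in>F. \<exists>h\<in>H. g = k \<circ> h"
proof -
  let ?\<Gamma> = "tree_Aut adj r\<lparr>carrier := G\<rparr>"
  have coset: "H #>\<^bsub>?\<Gamma>\<^esub> g = {h \<circ> g | h. h \<in> H}" for g
    by (auto simp: r_coset_def tree_Aut_def)
  have "rcosets\<^bsub>?\<Gamma>\<^esub> H = (\<lambda>g. H #>\<^bsub>?\<Gamma>\<^esub> g) ` G"
    by (auto simp: RCOSETS_def)
  then have "finite ((\<lambda>g. H #>\<^bsub>?\<Gamma>\<^esub> g) ` G)"
    using fin by (simp add: finite_index_def)
  then obtain F where F: "F \<subseteq> G" "finite F"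
      "(\<lambda>g. H #>\<^bsub>?\<Gamma>\<^esub> g) ` G = (\<lambda>g. H #>\<^bsub>?\<Gamma>\<^esub> g) ` F"
    by (meson finite_subset_image order_refl)
  have "\<exists>k\<in>inv_into UNIV ` F. \<exists>h\<in>H. g = k \<circ> h" if "g \<in> G" for g
  proof -
    have bij: "bij g" if "g \<in> G" for g
      using G that by (auto simp: subgroup_tree_Aut_iff in_tree_Aut_iff)
    have "inv_into UNIV g \<in> G" using G that by (simp add: subgroup_tree_Aut_iff)
    then obtain k where k: "k \<in> F" "H #>\<^bsub>?\<Gamma>\<^esub> inv_into UNIV g = H #>\<^bsub>?\<Gamma>\<^esub> k" using F(3) by blast
    have "id \<in> H" using H by (simp add: subgroup_tree_Aut_iff)
    then have "inv_into UNIV g \<in> H #>\<^bsub>?\<Gamma>\<^esub> inv_into UNIV g" unfolding coset by (auto intro!: exI[of _ id])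
    then have "inv_into UNIV g \<in> H #>\<^bsub>?\<Gamma>\<^esub> k" by (simp only: k(2))
    then obtain h where h: "h \<in> H" "inv_into UNIV g = h \<circ> k" unfolding coset by blast
    have "bij h" "bij k" using h(1) H k(1) F(1) bij by (auto simp: subgroup_tree_Aut_iff in_tree_Aut_iff)
    then have "g = inv_into UNIV k \<circ> inv_into UNIV h" using h(2) bij[OF that] by (metis inv_inv_eq o_inv_distrib)
    then show ?thesis using h(1) H k(1) by (auto simp: subgroup_tree_Aut_iff)
  qed
  moreover have "inv_into UNIV ` F \<subseteq> G" using F(1) G by (auto simp: subgroup_tree_Aut_iff)
  ultimately show thesis using that[of "inv_into UNIV ` F"] F(2) by blast
qed

section \<open>Stabilizers of closed sets\<close>

lemma Rist_subset_SStab: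
  assumes "is_tree adj" "C \<subseteq> boundary adj r" "\<And>\<xi> n. \<xi> \<in> C \<Longrightarrow> v \<noteq> \<xi> n"
  shows "Rist adj r G v \<subseteq> SStab G C"
proof
  fix g assume g: "g \<in> Rist adj r G v"
  have "g \<circ> \<xi> = \<xi>" if "\<xi> \<in> C" for \<xi>
  proof
    fix n
    \<comment> \<open>A ray can enter the subtree of \<open>v\<close> only through
      \<open>v\<close>.\<close>
    have "\<xi> n \<notin> subtree adj r v"
      using subtree_ray_iff[OF assms(1)] assms(2,3) that by blast
    then show "(g \<circ> \<xi>) n = \<xi> n" using g by (simp add: Rist_def)
  qed
  then show "g \<in> SStab G C" using g by (simp add: Rist_def SStab_def)
qed

text \<open>Serves twice: for proper overgroups \<open>K\<close> in the proof of maximality, and for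
  \<open>K = SStab G C\<close> in the proof of distinctness.\<close>

lemma finite_index_overgroup_SStab:
  assumes tree: "is_tree adj" and branch: "branch_group adj r G" and C: "C \<subseteq> boundary adj r"
    and min: "minimal_action adj r (SStab G C) C"
    and K: "subgroup K (tree_Aut adj r)" "K \<subseteq> G" "SStab G C \<subseteq> K"
    and "\<xi> \<in> C" "Rist adj r G (\<xi> n) \<subseteq> K"
  shows "finite_index (tree_Aut adj r\<lparr>carrier := G\<rparr>) K"
proof -
  have G: "subgroup G (tree_Aut adj r)" using branch by (simp add: branch_group_def)
  have "Rist adj r G u \<subseteq> K" if u: "u \<in> level adj r n" for u
  proof (cases "\<exists>\<eta>\<in>C. \<exists>m. u = \<eta> m")
    case True
    then obtain \<eta> m where \<eta>: "\<eta> \<in> C" "u = \<eta> m" by blast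
    have "m = n" using u graph_dist_ray[OF tree, of \<eta> r m] C \<eta> by (auto simp: level_def)
    \<comment> \<open>Minimality supplies an element of \<open>K\<close> that conjugates the given
      rigid stabilizer to that of \<open>u\<close>.\<close>
    obtain h where h: "h \<in> SStab G C" "h (\<xi> n) = \<eta> n"
      using minimal_action_transitive[OF tree C min assms(8) \<eta>(1)] .
    then show ?thesis
      using Rist_subset_conjugate[OF G K(1) _ _ assms(9), of h] K \<eta>(2) \<open>m = n\<close> by auto
  next
    case False
    then show ?thesis using Rist_subset_SStab[OF tree C, of u G] K(3) by blast
  qed
  then have "Rist_level adj r G n \<subseteq> K"
    unfolding Rist_level_def
    by (intro group.generate_subgroup_incl[OF group_tree_Aut _ K(1)]) blast
  moreover have "\<one>\<^bsub>tree_Aut adj r\<^esub> \<in> Rist_level adj r G n"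
    unfolding Rist_level_def by (rule generate.one)
  moreover have "subgroup K (tree_Aut adj r\<lparr>carrier := G\<rparr>)"
    using K subgroup_carrier_update_iff[OF group_tree_Aut G] by simp
  ultimately show ?thesis
    using branch subgroup.subgroup_is_group[OF G group_tree_Aut]
      finite_index_mono[of "tree_Aut adj r\<lparr>carrier := G\<rparr>" K "Rist_level adj r G n"]
    by (simp add: branch_group_def)
qed

section \<open>Infinite index of the stabilizer\<close>

text \<open>The combinatorial form of the fact that finitely many translates of a nowhere dense set
  do not cover a nonempty open set.\<close>

lemma exists_descendant_avoiding_translates:
  assumes tree: "is_tree adj" and V: "\<And>v w. w \<in> V \<Longrightarrow> w \<in> subtree adj r v \<Longrightarrow> v \<in> V"
    and nowhere_dense: "\<And>v. \<exists>w\<in>subtree adj r v. w \<notin> V"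
    and "finite F" "F \<subseteq> carrier (tree_Aut adj r)"
  shows "\<exists>w\<in>subtree adj r v. \<forall>k\<in>F. w \<notin> k ` V"
  using assms(4,5)
proof (induction F arbitrary: v)
  case empty
  then show ?case using subtree_refl[OF tree] by auto
next
  case (insert k F)
  then obtain w where w: "w \<in> subtree adj r v" "\<forall>k\<in>F. w \<notin> k ` V" by blast
  have bij: "bij k'" if "k' \<in> insert k F" for k'
    using insert.prems that by (auto simp: in_tree_Aut_iff)
  \<comment> \<open>Pulling \<open>w\<close> back by \<open>k\<close> and descending out of
    \<open>V\<close> gives a descendant \<open>k x\<close> of \<open>w\<close> outside the translate
    of \<open>V\<close> by \<open>k\<close>.\<close>
  obtain x where x: "x \<in> subtree adj r (inv_into UNIV k w)" "x \<notin> V" using nowhere_dense by blast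
  have kx: "k x \<in> subtree adj r w"
    using tree_Aut_subtree[OF _ x(1), of k] insert.prems bij
    by (simp add: bij_is_surj surj_f_inv_f)
  \<comment> \<open>The translates already avoided by \<open>w\<close> are avoided by its
    descendants too, because \<open>V\<close> is closed under ancestors.\<close>
  have "k x \<notin> k' ` V" if k': "k' \<in> F" for k'
  proof
    assume "k x \<in> k' ` V"
    then have "inv_into UNIV k' (k x) \<in> V" using bij k' by (auto simp: bij_is_inj)
    moreover have "inv_into UNIV k' \<in> carrier (tree_Aut adj r)"
      using insert.prems k' group.inv_closed[OF group_tree_Aut] inv_tree_Aut
      by (metis insertCI subsetD)
    ultimately have "inv_into UNIV k' w \<in> V" using V tree_Aut_subtree[OF _ kx] by blast
    moreover have "w = k' (inv_into UNIV k' w)" using bij k' by (simp add: bij_is_surj surj_f_inv_f)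
    ultimately have "w \<in> k' ` V" by (rule image_eqI[rotated])
    with w(2) k' show False by blast
  qed
  moreover have "k x \<notin> k ` V" using x(2) bij by (auto simp: bij_is_inj inj_eq)
  ultimately show ?case using subtree_trans[OF tree kx w(1)] by blast
qed

lemma infinite_index_SStab:
  assumes tree: "is_tree adj" and branch: "branch_group adj r G"
    and closed: "closedin (boundary_top adj r) C" and not_open: "\<not> openin (boundary_top adj r) C"
    and min: "minimal_action adj r (SStab G C) C"
  shows "\<not> finite_index (tree_Aut adj r\<lparr>carrier := G\<rparr>) (SStab G C)"
proof
  assume fin: "finite_index (tree_Aut adj r\<lparr>carrier := G\<rparr>) (SStab G C)"
  have G: "subgroup G (tree_Aut adj r)"
    and trans: "\<And>n u v. u \<in> level adj r n \<Longrightarrow> v \<in> level adj r n \<Longrightarrow> \<exists>g\<in>G. g u = v"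
    using branch unfolding branch_group_def by blast+
  have C: "C \<subseteq> boundary adj r"
    using closedin_subset[OF closed] by (simp add: topspace_boundary_top)
  define V where "V = {\<xi> n | \<xi> n. \<xi> \<in> C}"
  have V_closed: "v \<in> V" if "w \<in> V" "w \<in> subtree adj r v" for v w
    using that C subtree_ray_iff[OF tree] unfolding V_def by blast
  have V_inv: "h v \<in> V" if "h \<in> SStab G C" "v \<in> V" for h v
  proof -
    obtain \<xi> n where "\<xi> \<in> C" "v = \<xi> n" using \<open>v \<in> V\<close> by (auto simp: V_def)
    then have "h \<circ> \<xi> \<in> C" "h v = (h \<circ> \<xi>) n" using that(1) by (auto simp: SStab_def)
    then show ?thesis unfolding V_def by blast
  qed
  obtain F where F: "finite F" "F \<subseteq> G" "\<And>g. g \<in> G \<Longrightarrow> \<exists>k\<in>F. \<exists>h\<in>SStab G C. g = k \<circ> h"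
    using finite_index_transversal[OF G subgroup_SStab[OF G] fin] by blast
  \<comment> \<open>The empty set is open, so \<open>C\<close> is nonempty.\<close>
  obtain \<xi> where \<xi>: "\<xi> \<in> C" using not_open by (cases "C = {}") auto
  \<comment> \<open>By level transitivity \<open>v = g (\<xi> n)\<close>, and the factor
    \<open>h\<close> of \<open>g = k \<circ> h\<close> keeps \<open>\<xi> n\<close> inside
    \<open>V\<close>.\<close>
  have cover: "\<exists>k\<in>F. v \<in> k ` V" for v
  proof -
    define n where "n = graph_dist adj r v"
    have "\<xi> n \<in> level adj r n" "v \<in> level adj r n"
      using graph_dist_ray[OF tree] C \<xi> by (auto simp: level_def n_def)
    then obtain g where "g \<in> G" "g (\<xi> n) = v" using trans by blast
    moreover obtain k h where "k \<in> F" "h \<in> SStab G C" "g = k \<circ> h" using F(3) \<open>g \<in> G\<close> by blast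
    moreover have "h (\<xi> n) \<in> V" using V_inv \<open>h \<in> SStab G C\<close> \<xi> unfolding V_def by blast
    ultimately show ?thesis by auto
  qed
  have F': "F \<subseteq> carrier (tree_Aut adj r)" using F(2) G by (auto simp: subgroup_tree_Aut_iff)
  obtain v where v: "subtree adj r v \<subseteq> V"
  proof (rule ccontr)
    assume "\<not> thesis"
    then have "\<exists>w\<in>subtree adj r v. w \<notin> V" for v using that by blast
    then obtain w where "\<forall>k\<in>F. w \<notin> k ` V"
      using exists_descendant_avoiding_translates[OF tree _ _ F(1) F', of V] V_closed by blast
    with cover show False by blast
  qed
  then have "v \<in> V" using subtree_refl[OF tree] by blast
  then obtain \<xi> n where \<xi>: "\<xi> \<in> C" "v = \<xi> n" by (auto simp: V_def)
  \<comment> \<open>The level \<open>n\<close> of \<open>v\<close> serves for every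
    \<open>\<eta>\<close>: some \<open>h\<close> in the stabilizer moves \<open>\<eta> n\<close> to
    \<open>v\<close>, so the subtree of \<open>\<eta> n\<close> lies in \<open>V\<close> as
    well.\<close>
  have "\<zeta> \<in> C" if \<eta>: "\<eta> \<in> C" and \<zeta>: "\<zeta> \<in> boundary adj r" "\<zeta> n = \<eta> n" for \<eta> \<zeta>
  proof -
    obtain h where h: "h \<in> SStab G C" "h (\<eta> n) = \<xi> n"
      using minimal_action_transitive[OF tree C min \<eta> \<xi>(1)] .
    have H: "h \<in> carrier (tree_Aut adj r)" "inv_into UNIV h \<in> SStab G C"
      using h(1) subgroup_SStab[OF G, of C] by (auto simp: subgroup_tree_Aut_iff)
    have V\<zeta>: "\<zeta> m \<in> V" for m
    proof -
      \<comment> \<open>Below level \<open>n\<close> the vertex \<open>\<zeta> m\<close> is not yet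
        in the subtree of \<open>\<eta> n\<close>; it is in \<open>V\<close> as an ancestor of
        \<open>\<zeta> n\<close>.\<close>
      let ?m = "max m n"
      have "\<zeta> ?m \<in> subtree adj r (\<eta> n)"
        using subtree_ray_iff[OF tree \<zeta>(1)] \<zeta>(2) by (metis max.cobounded2)
      then have "h (\<zeta> ?m) \<in> V" using tree_Aut_subtree[OF H(1)] h(2) \<xi>(2) v by fastforce
      then have "inv_into UNIV h (h (\<zeta> ?m)) \<in> V" by (rule V_inv[OF H(2)])
      then have "\<zeta> ?m \<in> V" using H(1) by (simp add: in_tree_Aut_iff bij_is_inj)
      then show ?thesis
        by (rule V_closed) (use subtree_ray_iff[OF tree \<zeta>(1)] in \<open>metis max.cobounded1\<close>)
    qed
    \<comment> \<open>A closed set contains every ray all of whose vertices lie on its rays.\<close>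
    show ?thesis
    proof (rule ccontr)
      assume "\<zeta> \<notin> C"
      then obtain m where "\<And>\<eta> k. \<eta> \<in> C \<Longrightarrow> \<zeta> m \<noteq> \<eta> k"
        using closedin_boundary_top_separate[OF tree closed \<zeta>(1)] by blast
      then show False using V\<zeta>[of m] by (auto simp: V_def)
    qed
  qed
  then have "openin (boundary_top adj r) C"
    using C unfolding openin_boundary_top_iff[OF tree] by blast
  with not_open show False ..
qed

section \<open>Weak maximality and distinctness\<close>

lemma weakly_maximal_SStab:
  assumes tree: "is_tree adj" and branch: "branch_group adj r G"
    and closed: "closedin (boundary_top adj r) C" and not_open: "\<not> openin (boundary_top adj r) C"
    and min: "minimal_action adj r (SStab G C) C"
  shows "weakly_maximal (tree_Aut adj r\<lparr>carrier := G\<rparr>) (SStab G C)"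
proof -
  have G: "subgroup G (tree_Aut adj r)" using branch by (simp add: branch_group_def)
  have C: "C \<subseteq> boundary adj r"
    using closedin_subset[OF closed] by (simp add: topspace_boundary_top)
  note sub = subgroup_carrier_update_iff[OF group_tree_Aut G]
  have "K = SStab G C"
    if K: "subgroup K (tree_Aut adj r)" "K \<subseteq> G" "SStab G C \<subseteq> K"
      and inf: "\<not> finite_index (tree_Aut adj r\<lparr>carrier := G\<rparr>) K" for K
  proof -
    have invariant: "g \<circ> \<xi> \<in> C" if g: "g \<in> K" and \<xi>: "\<xi> \<in> C" for g \<xi>
    proof (rule ccontr)
      assume "g \<circ> \<xi> \<notin> C"
      moreover have gA: "g \<in> carrier (tree_Aut adj r)" and g': "inv_into UNIV g \<in> K" "inv_into UNIV g \<in> G"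
        using g K by (auto simp: subgroup_tree_Aut_iff)
      moreover have "g \<circ> \<xi> \<in> boundary adj r" using tree_Aut_ray[OF gA] C \<xi> by blast
      ultimately obtain n where "\<And>\<eta> m. \<eta> \<in> C \<Longrightarrow> (g \<circ> \<xi>) n \<noteq> \<eta> m"
        using closedin_boundary_top_separate[OF tree closed] by metis
      then have "Rist adj r G (g (\<xi> n)) \<subseteq> K"
        using Rist_subset_SStab[OF tree C, of "g (\<xi> n)" G] K(3) by auto
      \<comment> \<open>Conjugation by the inverse of \<open>g\<close> returns to
        \<open>\<xi> n\<close>, a vertex on a ray of \<open>C\<close>.\<close>
      then have "Rist adj r G (inv_into UNIV g (g (\<xi> n))) \<subseteq> K"
        using Rist_subset_conjugate[OF G K(1)] g' by blast
      then have "Rist adj r G (\<xi> n) \<subseteq> K" using gA by (simp add: in_tree_Aut_iff bij_is_inj)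
      with finite_index_overgroup_SStab[OF tree branch C min K \<xi>] inf show False by blast
    qed
    have "g \<in> SStab G C" if g: "g \<in> K" for g
    proof -
      have "inv_into UNIV g \<in> K" "bij g" using g K by (auto simp: subgroup_tree_Aut_iff in_tree_Aut_iff)
      \<comment> \<open>So far \<open>g\<close> maps \<open>C\<close> into itself; the same for its
        inverse makes the map onto.\<close>
      then have "\<xi> = g \<circ> (inv_into UNIV g \<circ> \<xi>)" "inv_into UNIV g \<circ> \<xi> \<in> C" if "\<xi> \<in> C" for \<xi>
        using invariant that by (auto simp: fun_eq_iff bij_is_surj surj_f_inv_f)
      then have "(\<lambda>\<xi>. g \<circ> \<xi>) ` C = C" using invariant[OF g] by blast
      with g K(2) show ?thesis by (auto simp: SStab_def)
    qed
    with K(3) show ?thesis by blast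
  qed
  moreover have "SStab G C \<subseteq> G" by (auto simp: SStab_def)
  ultimately show ?thesis
    unfolding weakly_maximal_def sub
    using subgroup_SStab[OF G] infinite_index_SStab[OF assms] by blast
qed

text \<open>Exchanging \<open>C\<close> and \<open>D\<close> gives the other inclusion, so a closed
  set of the required kind is recovered from its stabilizer.\<close>

lemma SStab_eq_imp_subset:
  assumes tree: "is_tree adj" and branch: "branch_group adj r G"
    and closed: "closedin (boundary_top adj r) C" and not_open: "\<not> openin (boundary_top adj r) C"
    and min: "minimal_action adj r (SStab G C) C"
    and closed': "closedin (boundary_top adj r) D" and eq: "SStab G C = SStab G D"
  shows "C \<subseteq> D"
proof
  fix \<xi> assume \<xi>: "\<xi> \<in> C"
  have sub: "C \<subseteq> boundary adj r" "D \<subseteq> boundary adj r"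
    using closed closed' closedin_subset by (metis topspace_boundary_top)+
  show "\<xi> \<in> D"
  proof (rule ccontr)
    assume "\<xi> \<notin> D"
    then obtain n where "\<And>\<eta> m. \<eta> \<in> D \<Longrightarrow> \<xi> n \<noteq> \<eta> m"
      using closedin_boundary_top_separate[OF tree closed'] sub \<xi> by blast
    then have "Rist adj r G (\<xi> n) \<subseteq> SStab G C"
      unfolding eq by (rule Rist_subset_SStab[OF tree sub(2)])
    moreover have "subgroup (SStab G C) (tree_Aut adj r)"
      using branch by (simp add: branch_group_def subgroup_SStab)
    moreover have "SStab G C \<subseteq> G" by (auto simp: SStab_def)
    \<comment> \<open>The stabilizer is taken as its own overgroup here.\<close>
    ultimately have "finite_index (tree_Aut adj r\<lparr>carrier := G\<rparr>) (SStab G C)"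
      using finite_index_overgroup_SStab[OF tree branch sub(1) min _ _ _ \<xi>] by blast
    then show False using infinite_index_SStab[OF tree branch closed not_open min] by blast
  qed
qed

theorem theorem1p5:
  fixes adj :: "'v \<Rightarrow> 'v \<Rightarrow> bool" and r :: 'v and G :: "('v \<Rightarrow> 'v) set"
  assumes "rooted_tree adj r"
    and "branch_group adj r G"
  shows "(\<forall>H. generalized_parabolic adj r G H \<longrightarrow>
              weakly_maximal (tree_Aut adj r\<lparr>carrier := G\<rparr>) H) \<and>
         (\<forall>C\<^sub>1 C\<^sub>2.
              closedin (boundary_top adj r) C\<^sub>1 \<and> \<not> openin (boundary_top adj r) C\<^sub>1 \<and>
              closedin (boundary_top adj r) C\<^sub>2 \<and> \<not> openin (boundary_top adj r) C\<^sub>2 \<and>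
              minimal_action adj r (SStab G C\<^sub>1) C\<^sub>1 \<and> minimal_action adj r (SStab G C\<^sub>2) C\<^sub>2 \<and>
              C\<^sub>1 \<noteq> C\<^sub>2 \<longrightarrow> SStab G C\<^sub>1 \<noteq> SStab G C\<^sub>2)"
proof -
  have tree: "is_tree adj" using assms(1) by (simp add: rooted_tree_def)
  show ?thesis
    using weakly_maximal_SStab[OF tree assms(2)] SStab_eq_imp_subset[OF tree assms(2)]
    unfolding generalized_parabolic_def by (metis subset_antisym)
qed

end
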